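(* Let $d$ be a positive integer and $\chi$ a primitive Dirichlet character of conductor $d$. Let $w_1,w_2,w_3$ be any positive integers and $n\ge0$ an integer. Then \begin{align*} &\sum_{k+l+m=n}\binom{n}{k,l,m}S_{k}(w_{1}d-1,\chi)S_{l}(w_{2}d-1,\chi)S_{m}(w_{3}d-1,\chi)w_{3}^{k-1}w_{1}^{l-1}w_{2}^{m-1}\\ =&\sum_{k+l+m=n}\binom{n}{k,l,m}S_{k}(w_{1}d-1,\chi)S_{l}(w_{3}d-1,\chi)S_{m}(w_{2}d-1,\chi)w_{2}^{k-1}w_{1}^{l-1}w_{3}^{m-1}. \end{align*}
   Context: The character $\chi$ is regarded as a function on integers (periodic mod $d$, with $\chi(a)=0$ when $\gcd(a,d)>1$; for $d=1$, $\chi\equiv 1$), with values in $\overline{\mathbb{Q}}$. The generalized power sum is $S_k(N,\chi)=\sum_{a=0}^{N}\chi(a)a^k$ (with $0^0=1$). Sums are over nonnegative integers $k,l,m$ with $k+l+m=n$, and $\binom{n}{k,l,m}=\frac{n!}{k!l!m!}$. *)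

theory Defs
  imports
    "HOL-Algebra.Algebraic_Closure_Type"
    "HOL-Number_Theory.Cong"
begin

text \<open>
  Characters are functions on all integers, extended by zero. For modulus 1 this
  forces the constant function 1, since 0 is then coprime to the modulus.
\<close>

definition dirichlet_character :: "nat \<Rightarrow> (int \<Rightarrow> 'a::field) \<Rightarrow> bool" where
  "dirichlet_character d \<chi> \<longleftrightarrow> d > 0 \<and>
     (\<forall>a b. [a = b] (mod int d) \<longrightarrow> \<chi> a = \<chi> b) \<and>
     (\<forall>a b. \<chi> (a * b) = \<chi> a * \<chi> b) \<and>
     (\<forall>a. \<chi> a = 0 \<longleftrightarrow> \<not> coprime a (int d))"

text \<open>
  \<open>e\<close> is an induced modulus of \<open>\<chi>\<close> modulo \<open>d\<close> iff \<open>\<chi>\<close>, on the units modulo \<open>d\<close>,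
  factors through the units modulo \<open>e\<close>. The conductor is the least such \<open>e\<close>; the
  set is nonempty, as it contains \<open>d\<close>.
\<close>

definition induced_modulus :: "nat \<Rightarrow> (int \<Rightarrow> 'a::field) \<Rightarrow> nat \<Rightarrow> bool" where
  "induced_modulus d \<chi> e \<longleftrightarrow> e > 0 \<and> e dvd d \<and>
     (\<forall>a. coprime a (int d) \<and> [a = 1] (mod int e) \<longrightarrow> \<chi> a = 1)"

definition conductor :: "nat \<Rightarrow> (int \<Rightarrow> 'a::field) \<Rightarrow> nat" where
  "conductor d \<chi> = (LEAST e. induced_modulus d \<chi> e)"

definition primitive_character :: "nat \<Rightarrow> (int \<Rightarrow> 'a::field) \<Rightarrow> bool" where
  "primitive_character d \<chi> \<longleftrightarrow> dirichlet_character d \<chi> \<and> conductor d \<chi> = d"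

definition gen_power_sum :: "nat \<Rightarrow> nat \<Rightarrow> (int \<Rightarrow> 'a::field) \<Rightarrow> 'a" where
  "gen_power_sum k N \<chi> = (\<Sum>a=0..N. \<chi> (int a) * of_nat a ^ k)"

definition trinomial :: "nat \<Rightarrow> nat \<Rightarrow> nat \<Rightarrow> nat \<Rightarrow> 'a::field_char_0" where
  "trinomial n k l m = fact n / (fact k * fact l * fact m)"

end

theory Submission
  imports Defs "HOL-Computational_Algebra.Formal_Power_Series"
begin

text \<open>
  With \<open>F\<^sub>w(t) = (\<Sum>a<wd. \<chi>(a) e\<^sup>a\<^sup>t)\<close>, the left-hand side is \<open>n! / (w\<^sub>1w\<^sub>2w\<^sub>3)\<close> times the
  coefficient of \<open>t\<^sup>n\<close> in \<open>F\<^bsub>w\<^sub>1\<^esub>(w\<^sub>3t) F\<^bsub>w\<^sub>2\<^esub>(w\<^sub>1t) F\<^bsub>w\<^sub>3\<^esub>(w\<^sub>2t)\<close>. By periodicity of \<open>\<chi>\<close>,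
  \<open>F\<^sub>w(t) = F\<^sub>1(t) (e\<^sup>w\<^sup>d\<^sup>t - 1) / (e\<^sup>d\<^sup>t - 1)\<close>, so the product of the three factors is
  symmetric under exchanging \<open>w\<^sub>2\<close> and \<open>w\<^sub>3\<close>.
\<close>

text \<open>The scaling \<open>x\<close> sits in the exponents, so \<open>F\<^sub>w(xt)\<close> is
  \<open>char_exp_sum (w * d) \<chi> x\<close> and no composition of power series arises.\<close>

definition char_exp_sum :: "nat \<Rightarrow> (int \<Rightarrow> 'a::field_char_0) \<Rightarrow> 'a \<Rightarrow> 'a fps" where
  "char_exp_sum N \<chi> x = (\<Sum>a<N. fps_const (\<chi> (int a)) * fps_exp (of_nat a * x))"

lemma char_exp_sum_nth:
  assumes "N > 0"
  shows "char_exp_sum N \<chi> x $ k = gen_power_sum k (N - 1) \<chi> * x ^ k / fact k"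
proof -
  \<comment> \<open>Fails for \<open>N = 0\<close>: truncated subtraction would keep the term at
    0.\<close>
  have "{0..N - 1} = {..<N}"
    using assms by auto
  then show ?thesis
    by (simp add: char_exp_sum_def gen_power_sum_def fps_sum_nth sum_distrib_left
        sum_divide_distrib power_mult_distrib mult_ac)
qed

text \<open>By periodicity each further block of \<open>d\<close> terms is the first block times an
  exponential, giving a geometric sum. It is stated without division because
  \<open>fps_exp (of_nat d * x) - 1\<close> has constant term 0 and so is not a unit.\<close>

lemma char_exp_sum_mult:
  fixes \<chi> :: "int \<Rightarrow> 'a::field_char_0"
  assumes periodic: "\<And>a b. [a = b] (mod int d) \<Longrightarrow> \<chi> a = \<chi> b"
  shows "char_exp_sum (w * d) \<chi> x * (fps_exp (of_nat d * x) - 1)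
    = char_exp_sum d \<chi> x * (fps_exp (of_nat (w * d) * x) - 1)"
proof (induction w)
  case 0
  then show ?case by (simp add: char_exp_sum_def)
next
  case (Suc w)
  let ?f = "\<lambda>a. fps_const (\<chi> (int a)) * fps_exp (of_nat a * x)"
  let ?E = "fps_exp (of_nat (w * d) * x)"
  have shift: "?f (w * d + a) = ?E * ?f a" for a
  proof -
    have "\<chi> (int (w * d + a)) = \<chi> (int a)"
      by (rule periodic) (simp add: cong_def)
    moreover have "fps_exp (of_nat (w * d + a) * x) = ?E * fps_exp (of_nat a * x)"
      by (simp add: fps_exp_add_mult[symmetric] algebra_simps)
    ultimately show ?thesis by (simp add: mult_ac)
  qed
  have split: "(\<Sum>a<m + n. g a) = (\<Sum>a<m. g a) + (\<Sum>a<n. g (m + a))"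
    for g :: "nat \<Rightarrow> 'a fps" and m n
    by (induction n) (simp_all add: add.assoc)
  have "char_exp_sum (Suc w * d) \<chi> x = (\<Sum>a<w * d + d. ?f a)"
    by (simp add: char_exp_sum_def add.commute)
  also have "\<dots> = (\<Sum>a<w * d. ?f a) + (\<Sum>a<d. ?f (w * d + a))"
    by (rule split)
  also have "\<dots> = char_exp_sum (w * d) \<chi> x + ?E * char_exp_sum d \<chi> x"
    by (simp only: shift char_exp_sum_def sum_distrib_left)
  finally have step: "char_exp_sum (Suc w * d) \<chi> x
    = char_exp_sum (w * d) \<chi> x + ?E * char_exp_sum d \<chi> x" .
  have "fps_exp (of_nat (Suc w * d) * x) = ?E * fps_exp (of_nat d * x)"
    by (simp add: fps_exp_add_mult[symmetric] algebra_simps)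
  with Suc.IH show ?case
    unfolding step by (simp add: algebra_simps)
qed

lemma fps_exp_neq_1:
  assumes "(c :: 'a::field_char_0) \<noteq> 0"
  shows "fps_exp c - 1 \<noteq> 0"
proof
  assume "fps_exp c - 1 = 0"
  then have "(fps_exp c - 1) $ 1 = 0" by simp
  then show False using assms by simp
qed

lemma char_exp_sum_prod_symmetric:
  fixes \<chi> :: "int \<Rightarrow> 'a::field_char_0" and d w1 w2 w3 :: nat
  defines "F \<equiv> \<lambda>u v. char_exp_sum (u * d) \<chi> (of_nat v)"
  assumes periodic: "\<And>a b. [a = b] (mod int d) \<Longrightarrow> \<chi> a = \<chi> b"
    and pos: "d > 0" "w1 > 0" "w2 > 0" "w3 > 0"
  shows "F w1 w3 * F w2 w1 * F w3 w2 = F w1 w2 * F w3 w1 * F w2 w3"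
proof -
  define D where "D v = fps_exp (of_nat (d * v) :: 'a) - 1" for v
  have D_nz: "D v \<noteq> 0" if "v > 0" for v
    unfolding D_def using that pos by (intro fps_exp_neq_1) simp
  have F: "F u v * D v = char_exp_sum d \<chi> (of_nat v) * D (u * v)" for u v
    using char_exp_sum_mult[where \<chi> = \<chi> and d = d, OF periodic, where w = u and x = "of_nat v"]
    by (simp add: F_def D_def mult_ac)
  \<comment> \<open>Each side has exactly one factor scaled by each of \<open>w1\<close>,
    \<open>w2\<close>, \<open>w3\<close>, so the same \<open>G\<close> clears all
    denominators.\<close>
  define G where "G = D w1 * D w2 * D w3"
  have "(F w1 w3 * F w2 w1 * F w3 w2) * G
      = (F w1 w3 * D w3) * (F w2 w1 * D w1) * (F w3 w2 * D w2)"
    by (simp add: G_def mult_ac)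
  \<comment> \<open>Both sides become the product of the three series
    \<open>char_exp_sum d \<chi> (of_nat v)\<close> with \<open>D (w1 * w2)\<close>,
    \<open>D (w1 * w3)\<close> and \<open>D (w2 * w3)\<close>.\<close>
  also have "\<dots> = (F w1 w2 * D w2) * (F w3 w1 * D w1) * (F w2 w3 * D w3)"
    unfolding F by (simp add: mult_ac)
  also have "\<dots> = (F w1 w2 * F w3 w1 * F w2 w3) * G"
    by (simp add: G_def mult_ac)
  finally show ?thesis
    using D_nz pos by (simp add: G_def)
qed

lemma fps_mult3_nth:
  fixes f g h :: "'a::semiring_0 fps"
  shows "(f * g * h) $ n = (\<Sum>(k, l, m) \<in> {(k, l, m). k + l + m = n}. f $ k * g $ l * h $ m)"
proof -
  have "(f * g * h) $ n
      = (\<Sum>(i, k) \<in> Sigma {0..n} (\<lambda>i. {0..i}). f $ k * g $ (i - k) * h $ (n - i))"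
    by (simp add: fps_mult_nth sum_distrib_right sum.Sigma)
  also have "\<dots> = (\<Sum>(k, l, m) \<in> {(k, l, m). k + l + m = n}. f $ k * g $ l * h $ m)"
    \<comment> \<open>Here \<open>i = k + l\<close> is the total degree taken from
      \<open>f * g\<close>.\<close>
    by (rule sum.reindex_bij_witness[where i = "\<lambda>(k, l, m). (k + l, k)"
          and j = "\<lambda>(i, k). (k, i - k, n - i)"]) auto
  finally show ?thesis .
qed

text \<open>The powers \<open>x ^ k\<close>, \<open>y ^ l\<close>, \<open>z ^ m\<close> and the
  inverse factorials belong to the coefficients of the three series; the shifts by -1 in the
  exponents leave \<open>1 / (x * y * z)\<close>.\<close>

lemma trinomial_gen_power_sum_eq:
  fixes \<chi> :: "int \<Rightarrow> 'a::field_char_0" and x y z :: 'a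
  assumes pos: "A > 0" "B > 0" "C > 0" and nz: "x \<noteq> 0" "y \<noteq> 0" "z \<noteq> 0"
  shows "(\<Sum>(k, l, m) \<in> {(k, l, m). k + l + m = n}.
        trinomial n k l m
        * gen_power_sum k (A - 1) \<chi> * gen_power_sum l (B - 1) \<chi> * gen_power_sum m (C - 1) \<chi>
        * x powi (int k - 1) * y powi (int l - 1) * z powi (int m - 1))
    = fact n / (x * y * z)
      * (char_exp_sum A \<chi> x * char_exp_sum B \<chi> y * char_exp_sum C \<chi> z) $ n"
  unfolding fps_mult3_nth sum_distrib_left
  by (rule sum.cong)
    (auto simp: char_exp_sum_nth pos nz trinomial_def power_int_diff field_simps)

theorem theorem8:
  fixes d n w1 w2 w3 :: nat
    and \<chi> :: "int \<Rightarrow> rat alg_closure"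
  assumes "d > 0" and "primitive_character d \<chi>"
    and "w1 > 0" and "w2 > 0" and "w3 > 0"
  shows
    "(\<Sum>(k, l, m) \<in> {(k, l, m). k + l + m = n}.
        trinomial n k l m
        * gen_power_sum k (w1 * d - 1) \<chi>
        * gen_power_sum l (w2 * d - 1) \<chi>
        * gen_power_sum m (w3 * d - 1) \<chi>
        * of_nat w3 powi (int k - 1) * of_nat w1 powi (int l - 1) * of_nat w2 powi (int m - 1))
   = (\<Sum>(k, l, m) \<in> {(k, l, m). k + l + m = n}.
        trinomial n k l m
        * gen_power_sum k (w1 * d - 1) \<chi>
        * gen_power_sum l (w3 * d - 1) \<chi>
        * gen_power_sum m (w2 * d - 1) \<chi>
        * of_nat w2 powi (int k - 1) * of_nat w1 powi (int l - 1) * of_nat w3 powi (int m - 1))"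
proof -
  have periodic: "\<chi> a = \<chi> b" if "[a = b] (mod int d)" for a b
    using assms that by (auto simp: primitive_character_def dirichlet_character_def)
  have pos: "w1 * d > 0" "w2 * d > 0" "w3 * d > 0"
    using assms by simp_all
  have nz: "of_nat w1 \<noteq> (0 :: rat alg_closure)" "of_nat w2 \<noteq> (0 :: rat alg_closure)"
    "of_nat w3 \<noteq> (0 :: rat alg_closure)"
    using assms by simp_all
  let ?F = "\<lambda>u v. char_exp_sum (u * d) \<chi> (of_nat v)"
  have symmetric: "?F w1 w3 * ?F w2 w1 * ?F w3 w2 = ?F w1 w2 * ?F w3 w1 * ?F w2 w3"
    by (rule char_exp_sum_prod_symmetric[OF periodic assms(1,3,4,5)])
  show ?thesis
    \<comment> \<open>The scalings \<open>(x, y, z)\<close> are \<open>(w3, w1, w2)\<close> on the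
      left and \<open>(w2, w1, w3)\<close> on the right, so the prefactors differ only in
      order.\<close>
    unfolding trinomial_gen_power_sum_eq[OF pos(1,2,3) nz(3,1,2)]
      trinomial_gen_power_sum_eq[OF pos(1,3,2) nz(2,1,3)]
      symmetric
    by (simp only: mult_ac)
qed

end
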